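(* For each real $q\ge 1$, the map $\Phi_q$ defined on $\mathbb{R}^n$ by $$\Phi_q(x):=\big[H_q(|x|)\big]^{\frac1q}$$ is a symmetric gauge function.
   Context: $\mathbb{S}^n$ denotes the unit sphere of $\mathbb{C}^n$, $\sigma$ the normalized Euclidean surface measure on it, and $\langle\cdot,\cdot\rangle$ the standard Hermitian inner product. For $q\ge1$ and $x\in\mathbb{R}^n_+$ (nonnegative coordinates), $H_q(x)=\int_{\mathbb{S}^n}\big(\langle X\xi,\xi\rangle\big)^q\,d\sigma(\xi)$ where $X=\mathrm{diag}(x_1,\dots,x_n)$. For $x\in\mathbb{R}^n$, $|x|=(|x_1|,\dots,|x_n|)$. A symmetric gauge function is a norm on $\mathbb{R}^n$ that is invariant under permutations and under sign changes of the coordinates. *)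

theory Defs
  imports "HOL-Analysis.Analysis" "HOL-Probability.Probability_Measure"
begin

text \<open>
  Euclidean surface measure on the unit sphere of a Euclidean space of real dimension \<open>d\<close>, as the
  measure occurring in polar coordinates: the surface measure of a Borel set \<open>A\<close> of the sphere
  is \<open>d\<close> times the Lebesgue measure of the cone \<open>{t *\<^sub>R \<xi> | 0 < t < 1, \<xi> \<in> A}\<close> over \<open>A\<close>,
  which is the preimage of \<open>A\<close> under radial projection of the punctured unit ball.
\<close>

definition sphere_measure :: "'a::euclidean_space measure" where
  "sphere_measure =
     scale_measure (of_nat DIM('a))
       (distr (restrict_space lborel (ball 0 1 - {0})) (restrict_space borel (sphere 0 1))
          (\<lambda>x. x /\<^sub>R norm x))"

lemma radial_projection_measurable:
  "(\<lambda>x::'a::euclidean_space. x /\<^sub>R norm x)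
     \<in> restrict_space lborel (ball 0 1 - {0}) \<rightarrow>\<^sub>M restrict_space borel (sphere 0 1)"
proof (rule measurable_restrict_space3)
  show "(\<lambda>x::'a. x /\<^sub>R norm x) \<in> lborel \<rightarrow>\<^sub>M borel"
    by measurable
qed auto

lemma emeasure_sphere_measure:
  fixes A :: "'a::euclidean_space set"
  assumes "A \<in> sets borel" "A \<subseteq> sphere 0 1"
  shows "emeasure sphere_measure A =
    of_nat DIM('a) * emeasure lborel {t *\<^sub>R \<xi> | t \<xi>. 0 < t \<and> t < 1 \<and> \<xi> \<in> A}"
proof -
  let ?B = "ball 0 1 - {0::'a}"
  have A: "A \<in> sets (restrict_space borel (sphere 0 1))"
    using assms by (simp add: sets_restrict_space_iff)
  have "(\<lambda>x. x /\<^sub>R norm x) -` A \<inter> ?B = {t *\<^sub>R \<xi> | t \<xi>. 0 < t \<and> t < 1 \<and> \<xi> \<in> A}" (is "?L = ?R")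
  proof
    show "?L \<subseteq> ?R"
    proof
      fix x assume x: "x \<in> ?L"
      then have "x = norm x *\<^sub>R (x /\<^sub>R norm x)" "0 < norm x" "norm x < 1" "x /\<^sub>R norm x \<in> A"
        by auto
      then show "x \<in> ?R" by blast
    qed
    show "?R \<subseteq> ?L"
    proof
      fix x assume "x \<in> ?R"
      then obtain t \<xi> where *: "x = t *\<^sub>R \<xi>" "0 < t" "t < 1" "\<xi> \<in> A" by blast
      moreover have "norm \<xi> = 1" using assms * by auto
      ultimately show "x \<in> ?L" by auto
    qed
  qed
  moreover have "emeasure (restrict_space lborel ?B) ((\<lambda>x. x /\<^sub>R norm x) -` A \<inter> ?B) =
      emeasure lborel ((\<lambda>x. x /\<^sub>R norm x) -` A \<inter> ?B)"
    by (rule emeasure_restrict_space) auto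
  ultimately show ?thesis
    by (simp add: sphere_measure_def emeasure_distr[OF radial_projection_measurable A]
        space_restrict_space)
qed

definition normalized_sphere_measure :: "'a::euclidean_space measure" where
  "normalized_sphere_measure = uniform_measure sphere_measure (sphere 0 1)"

lemma prob_space_normalized_sphere_measure:
  "prob_space (normalized_sphere_measure :: 'a::euclidean_space measure)"
  unfolding normalized_sphere_measure_def
proof (rule prob_space_uniform_measure)
  let ?C = "{t *\<^sub>R \<xi> | t \<xi>. 0 < t \<and> t < 1 \<and> \<xi> \<in> sphere (0::'a) 1}"
  have C: "?C = ball 0 1 - {0}"
  proof
    show "ball 0 1 - {0} \<subseteq> ?C"
    proof
      fix x :: 'a assume "x \<in> ball 0 1 - {0}"
      then have "x = norm x *\<^sub>R (x /\<^sub>R norm x)" "0 < norm x" "norm x < 1" "x /\<^sub>R norm x \<in> sphere 0 1"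
        by auto
      then show "x \<in> ?C" by blast
    qed
  qed auto
  have "emeasure lborel (ball (0::'a) 1 - {0}) = ennreal (measure lborel (ball (0::'a) 1))"
    using emeasure_lborel_ball_finite[of "0::'a" 1]
    by (subst emeasure_Diff) (auto intro!: emeasure_eq_ennreal_measure)
  moreover have "0 < measure lborel (ball (0::'a) 1)"
    by (rule content_ball_pos) simp
  ultimately have e: "emeasure sphere_measure (sphere (0::'a) 1) =
      of_nat DIM('a) * ennreal (measure lborel (ball (0::'a) 1))" "0 < measure lborel (ball (0::'a) 1)"
    using emeasure_sphere_measure[of "sphere (0::'a) 1"] unfolding C by simp_all
  show "emeasure sphere_measure (sphere (0::'a) 1) \<noteq> 0"
    using e by (simp add: ennreal_eq_0_iff not_le)
  show "emeasure sphere_measure (sphere (0::'a) 1) \<noteq> \<infinity>"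
    using e by (simp add: ennreal_mult_eq_top_iff)
qed

definition hermitian_inner :: "complex ^ 'n \<Rightarrow> complex ^ 'n \<Rightarrow> complex" where
  "hermitian_inner u v = (\<Sum>i\<in>UNIV. u $ i * cnj (v $ i))"

definition diag_matrix :: "real ^ 'n \<Rightarrow> complex ^ 'n ^ 'n" where
  "diag_matrix x = (\<chi> i j. if i = j then of_real (x $ i) else 0)"

text \<open>
  \<open>H q x\<close> is meant for \<open>x\<close> with nonnegative coordinates. Then the quadratic form
  is a nonnegative real number, so taking its real part loses nothing.
\<close>

definition H :: "real \<Rightarrow> real ^ 'n \<Rightarrow> real" where
  "H q x = (LINT \<xi>|normalized_sphere_measure.
              Re (hermitian_inner (diag_matrix x *v \<xi>) \<xi>) powr q)"

lemma hermitian_inner_diag_matrix: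
  "hermitian_inner (diag_matrix x *v \<xi>) \<xi> = of_real (\<Sum>i\<in>UNIV. x $ i * (cmod (\<xi> $ i))\<^sup>2)"
proof -
  have "(diag_matrix x *v \<xi>) $ i = of_real (x $ i) * \<xi> $ i" for i
    by (simp add: diag_matrix_def matrix_vector_mult_def if_distrib[of "\<lambda>c. c * _"] cong: if_cong)
  then show ?thesis
    by (simp add: hermitian_inner_def mult.assoc complex_norm_square[symmetric])
qed

definition Phi :: "real \<Rightarrow> real ^ 'n \<Rightarrow> real" where
  "Phi q x = H q \<bar>x\<bar> powr (1 / q)"

definition is_norm :: "('a::real_vector \<Rightarrow> real) \<Rightarrow> bool" where
  "is_norm N \<longleftrightarrow>
     (\<forall>x. 0 \<le> N x) \<and>
     (\<forall>x. N x = 0 \<longleftrightarrow> x = 0) \<and>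
     (\<forall>c x. N (c *\<^sub>R x) = \<bar>c\<bar> * N x) \<and>
     (\<forall>x y. N (x + y) \<le> N x + N y)"

definition symmetric_gauge :: "(real ^ 'n \<Rightarrow> real) \<Rightarrow> bool" where
  "symmetric_gauge N \<longleftrightarrow>
     is_norm N \<and>
     (\<forall>p x. p permutes UNIV \<longrightarrow> N (\<chi> i. x $ p i) = N x) \<and>
     (\<forall>s x. (\<forall>i. s i \<in> {- 1, 1}) \<longrightarrow> N (\<chi> i. s i * x $ i) = N x)"

end

(*
  Phi q x is the L^q norm over the sphere of F_x(xi) = sum_i |x_i| |xi_i|^2, which is sublinear in x.
  Minkowski's inequality makes Phi q a seminorm that is monotone in |x|. Permuting the coordinates
  of xi preserves Lebesgue measure and the norm, hence the sphere measure, so Phi q is symmetric.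
  For definiteness, no null set has to be identified: since F_(1,...,1) = 1 on the sphere,
  1 = Phi q (1,...,1) <= sum_j Phi q e_j, and the e_j all have the same value by symmetry, so that
  value is positive; then Phi q x >= |x_k| Phi q e_k.
*)
theory Submission
  imports Defs
begin

section \<open>Convexity of powers and Minkowski's inequality\<close>

text \<open>If one endpoint is 0, the claim reduces to \<open>s powr p \<le> s\<close> for
  \<open>s\<close> in [0, 1]; for two positive endpoints it is the convexity of the power
  function.\<close>

lemma powr_convex_nonneg:
  fixes x y p t :: real
  assumes p: "1 \<le> p" and x: "0 \<le> x" and y: "0 \<le> y" and t: "0 \<le> t" "t \<le> 1"
  shows "((1 - t) * x + t * y) powr p \<le> (1 - t) * x powr p + t * y powr p"
proof -
  have scale: "(s * z) powr p \<le> s * z powr p" if "0 \<le> s" "s \<le> 1" "0 \<le> z" for s z :: real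
  proof -
    have "s powr p \<le> s"
      using that p powr_mono'[of 1 p s] by simp
    then show ?thesis
      using that by (simp add: powr_mult mult_right_mono)
  qed
  consider "x = 0" | "y = 0" | "0 < x" "0 < y"
    using x y by linarith
  then show ?thesis
  proof cases
    case 1
    then show ?thesis using scale[of t y] t y p by simp
  next
    case 2
    then show ?thesis using scale[of "1 - t" x] t x p by simp
  next
    case 3
    then show ?thesis
      using convex_onD[OF powr_convex[OF p], of t x y] t by simp
  qed
qed

text \<open>The quotient \<open>(u + v) / (a + b)\<close> is the convex combination of
  \<open>u / a\<close> and \<open>v / b\<close> with weights \<open>a / (a + b)\<close> and
  \<open>b / (a + b)\<close>. This is the pointwise form of Minkowski's inequality, to be integrated
  with \<open>a\<close> and \<open>b\<close> close to the norms of the two functions.\<close>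

lemma powr_add_le_weighted:
  fixes u v a b p :: real
  assumes p: "1 \<le> p" and u: "0 \<le> u" and v: "0 \<le> v" and a: "0 < a" and b: "0 < b"
  shows "(u + v) powr p
    \<le> (a + b) powr p * (a / (a + b) * (u powr p / a powr p) + b / (a + b) * (v powr p / b powr p))"
proof -
  define t where "t = b / (a + b)"
  have t: "0 \<le> t" "t \<le> 1" "1 - t = a / (a + b)"
    using a b by (auto simp: t_def field_simps)
  have "u + v = (a + b) * ((1 - t) * (u / a) + t * (v / b))"
    unfolding t(3) distrib_left using a b by (simp add: t_def)
  then have "(u + v) powr p = (a + b) powr p * ((1 - t) * (u / a) + t * (v / b)) powr p"
    using a b u v t by (subst powr_mult[symmetric]) (auto intro!: add_nonneg_nonneg)
  also have "\<dots> \<le> (a + b) powr p * ((1 - t) * (u / a) powr p + t * (v / b) powr p)"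
    using a b u v t p by (intro mult_left_mono powr_convex_nonneg) auto
  finally show ?thesis
    using a b u v by (simp add: powr_divide t(3)) (simp add: t_def)
qed

text \<open>The pointwise bound with \<open>a = b = 1\<close> gives an integrable majorant.\<close>

lemma integrable_powr_add:
  fixes f g :: "'a \<Rightarrow> real"
  assumes p: "1 \<le> p"
    and f: "f \<in> borel_measurable M" "\<And>x. x \<in> space M \<Longrightarrow> 0 \<le> f x" "integrable M (\<lambda>x. f x powr p)"
    and g: "g \<in> borel_measurable M" "\<And>x. x \<in> space M \<Longrightarrow> 0 \<le> g x" "integrable M (\<lambda>x. g x powr p)"
  shows "integrable M (\<lambda>x. (f x + g x) powr p)"
proof (rule Bochner_Integration.integrable_bound)
  show "integrable M (\<lambda>x. 2 powr p * (f x powr p / 2 + g x powr p / 2))"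
    using f g by simp
  show "(\<lambda>x. (f x + g x) powr p) \<in> borel_measurable M"
    using f(1) g(1) by measurable
  show "AE x in M. norm ((f x + g x) powr p) \<le> norm (2 powr p * (f x powr p / 2 + g x powr p / 2))"
  proof (rule AE_I2)
    fix x assume "x \<in> space M"
    then show "norm ((f x + g x) powr p) \<le> norm (2 powr p * (f x powr p / 2 + g x powr p / 2))"
      using powr_add_le_weighted[OF p f(2) g(2), of x x 1 1] by simp
  qed
qed

text \<open>Integrating the pointwise bound, with \<open>a\<close> and \<open>b\<close> just above
  the norms of \<open>f\<close> and \<open>g\<close>, leaves a convex combination of two normalized
  integrals, each at most 1. Hence the integral of the \<open>p\<close>-th power of the sum is at
  most \<open>(a + b) powr p\<close>.\<close>

lemma Minkowski_integral_powr:
  fixes f g :: "'a \<Rightarrow> real"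
  assumes p: "1 \<le> p"
    and f: "f \<in> borel_measurable M" "\<And>x. x \<in> space M \<Longrightarrow> 0 \<le> f x" "integrable M (\<lambda>x. f x powr p)"
    and g: "g \<in> borel_measurable M" "\<And>x. x \<in> space M \<Longrightarrow> 0 \<le> g x" "integrable M (\<lambda>x. g x powr p)"
  shows "(LINT x|M. (f x + g x) powr p) powr (1 / p)
    \<le> (LINT x|M. f x powr p) powr (1 / p) + (LINT x|M. g x powr p) powr (1 / p)"
    (is "?I powr _ \<le> ?F powr _ + ?G powr _")
proof (rule field_le_epsilon)
  fix e :: real assume e: "0 < e"
  txt \<open>Shifting by \<open>e / 2\<close> keeps the convex weights defined when one of the norms vanishes.\<close>
  have nn: "0 \<le> ?F" "0 \<le> ?G" "0 \<le> ?I"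
    by auto
  define a b where "a = ?F powr (1 / p) + e / 2" and "b = ?G powr (1 / p) + e / 2"
  have pos: "0 < a" "0 < b"
    using e by (auto simp: a_def b_def intro: add_nonneg_pos)
  have le1: "?F / a powr p \<le> 1" "?G / b powr p \<le> 1"
  proof -
    have "(?F powr (1 / p)) powr p \<le> a powr p" "(?G powr (1 / p)) powr p \<le> b powr p"
      using e p by (auto simp: a_def b_def intro!: powr_mono2)
    then show "?F / a powr p \<le> 1" "?G / b powr p \<le> 1"
      using pos p nn by (simp_all add: powr_powr)
  qed
  have "?I \<le> (LINT x|M. (a + b) powr p
      * (a / (a + b) * (f x powr p / a powr p) + b / (a + b) * (g x powr p / b powr p)))"
    using f g pos p by (intro integral_mono integrable_powr_add powr_add_le_weighted) auto
  also have "\<dots> = (a + b) powr p * (a / (a + b) * (?F / a powr p) + b / (a + b) * (?G / b powr p))"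
    using f g by simp
  also have "\<dots> \<le> (a + b) powr p * (a / (a + b) * 1 + b / (a + b) * 1)"
    using pos le1 by (intro mult_left_mono add_mono) auto
  also have "\<dots> = (a + b) powr p"
    using pos by (simp add: add_divide_distrib[symmetric])
  finally have "?I powr (1 / p) \<le> ((a + b) powr p) powr (1 / p)"
    using p nn by (intro powr_mono2) auto
  also have "\<dots> = a + b"
    using p pos by (simp add: powr_powr)
  finally show "?I powr (1 / p) \<le> ?F powr (1 / p) + ?G powr (1 / p) + e"
    by (simp add: a_def b_def)
qed

section \<open>Lebesgue measure under permutations of the coordinates\<close>

text \<open>Lebesgue measure is determined by its values on boxes, and the preimage of a box is a
  box with the same side lengths in another order.\<close>

lemma lborel_distr_permute_Basis:
  fixes T :: "'a::euclidean_space \<Rightarrow> 'a"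
  assumes \<pi>: "bij_betw \<pi> Basis Basis"
    and T: "\<And>x b. b \<in> Basis \<Longrightarrow> T x \<bullet> b = x \<bullet> \<pi> b"
    and meas: "T \<in> borel_measurable borel"
  shows "distr lborel borel T = lborel"
proof (rule lborel_eqI[symmetric])
  fix l u :: 'a assume le: "\<And>b. b \<in> Basis \<Longrightarrow> l \<bullet> b \<le> u \<bullet> b"
  define \<rho> where "\<rho> = inv_into Basis \<pi>"
  have \<rho>: "\<rho> b \<in> Basis" "\<pi> (\<rho> b) = b" if "b \<in> Basis" for b
    using \<pi> that by (auto simp: \<rho>_def bij_betw_def inv_into_into f_inv_into_f)
  have \<pi>': "\<pi> b \<in> Basis" "\<rho> (\<pi> b) = b" if "b \<in> Basis" for b
    using \<pi> that by (auto simp: \<rho>_def bij_betw_def)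
  \<comment> \<open>\<open>S\<close> is the inverse of \<open>T\<close> in coordinates; it yields
    the corners of the preimage box.\<close>
  define S where "S x = (\<Sum>b\<in>Basis. (x \<bullet> \<rho> b) *\<^sub>R b)" for x :: 'a
  have S: "S x \<bullet> b = x \<bullet> \<rho> b" if "b \<in> Basis" for x b
    using that by (simp add: S_def)
  have "T -` box l u = box (S l) (S u)"
  proof (rule set_eqI)
    fix x
    have "x \<in> T -` box l u \<longleftrightarrow> (\<forall>b\<in>Basis. l \<bullet> b < x \<bullet> \<pi> b \<and> x \<bullet> \<pi> b < u \<bullet> b)"
      by (simp add: mem_box T)
    also have "\<dots> \<longleftrightarrow> (\<forall>b\<in>Basis. l \<bullet> \<rho> b < x \<bullet> b \<and> x \<bullet> b < u \<bullet> \<rho> b)"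
      using \<rho> \<pi>' by metis
    also have "\<dots> \<longleftrightarrow> x \<in> box (S l) (S u)"
      by (simp add: mem_box S)
    finally show "x \<in> T -` box l u \<longleftrightarrow> x \<in> box (S l) (S u)" .
  qed
  then have "emeasure (distr lborel borel T) (box l u) = emeasure lborel (box (S l) (S u))"
    using meas by (simp add: emeasure_distr)
  also have "\<dots> = (\<Prod>b\<in>Basis. (S u - S l) \<bullet> b)"
    using le \<rho> by (intro emeasure_lborel_box) (simp add: S)
  also have "(\<Prod>b\<in>Basis. (S u - S l) \<bullet> b) = (\<Prod>b\<in>Basis. (u - l) \<bullet> \<rho> b)"
    by (intro prod.cong) (auto simp: S inner_diff_left)
  also have "\<dots> = (\<Prod>b\<in>Basis. (u - l) \<bullet> b)"
    by (rule prod.reindex_bij_betw) (simp add: \<rho>_def \<pi> bij_betw_inv_into)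
  finally show "emeasure (distr lborel borel T) (box l u) = (\<Prod>b\<in>Basis. (u - l) \<bullet> b)" .
qed simp

section \<open>Linear isometries and the normalized sphere measure\<close>

lemma sets_sphere_measure: "sets sphere_measure = sets (restrict_space borel (sphere 0 1))"
  by (simp add: sphere_measure_def)

lemma sets_normalized_sphere_measure [measurable_cong]:
  "sets normalized_sphere_measure = sets (restrict_space borel (sphere 0 1))"
  by (simp add: normalized_sphere_measure_def sets_sphere_measure)

lemma space_normalized_sphere_measure: "space normalized_sphere_measure = sphere 0 1"
  using sets_eq_imp_space_eq[OF sets_normalized_sphere_measure] by (simp add: space_restrict_space)

lemma borel_measurable_normalized_sphere_measure:
  "f \<in> borel_measurable borel \<Longrightarrow> f \<in> borel_measurable normalized_sphere_measure"
  by (simp add: measurable_cong_sets[OF sets_normalized_sphere_measure refl]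
      measurable_restrict_space1)

lemma measurable_normalized_sphere_measure:
  assumes "T \<in> borel \<rightarrow>\<^sub>M borel" "\<And>x. norm (T x) = norm x"
  shows "T \<in> normalized_sphere_measure \<rightarrow>\<^sub>M normalized_sphere_measure"
  unfolding measurable_cong_sets[OF sets_normalized_sphere_measure sets_normalized_sphere_measure]
  by (rule measurable_restrict_space3) (auto simp: assms)

lemma borel_measurable_linear:
  fixes T :: "'a::euclidean_space \<Rightarrow> 'b::real_normed_vector"
  shows "linear T \<Longrightarrow> T \<in> borel_measurable borel"
  by (intro borel_measurable_continuous_onI linear_continuous_on) (simp add: linear_conv_bounded_linear)

text \<open>The surface measure of \<open>A\<close> is a constant times the Lebesgue measure of the
  cone over \<open>A\<close>. A linear isometry commutes with forming cones under preimages, so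
  invariance of Lebesgue measure passes to the sphere.\<close>

lemma normalized_sphere_measure_distr:
  fixes T :: "'a::euclidean_space \<Rightarrow> 'a"
  assumes lborel: "distr lborel borel T = lborel"
    and lin: "linear T" and iso: "\<And>x. norm (T x) = norm x"
  shows "distr normalized_sphere_measure normalized_sphere_measure T = normalized_sphere_measure"
proof -
  let ?\<mu> = "normalized_sphere_measure :: 'a measure" and ?S = "sphere (0::'a) 1"
  define cone where "cone A = {t *\<^sub>R \<xi> | t \<xi>. 0 < t \<and> t < 1 \<and> \<xi> \<in> A}" for A :: "'a set"
  have [measurable]: "T \<in> borel_measurable borel"
    using lin by (rule borel_measurable_linear)
  have T: "T \<in> ?\<mu> \<rightarrow>\<^sub>M ?\<mu>"
    by (rule measurable_normalized_sphere_measure) (auto simp: iso)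
  have em: "emeasure sphere_measure A = of_nat DIM('a) * emeasure lborel (cone A)"
    if "A \<in> sets borel" "A \<subseteq> ?S" for A
    using emeasure_sphere_measure[OF that] by (simp add: cone_def)
  have cone_meas: "cone A \<in> sets borel" if A: "A \<in> sets borel" "A \<subseteq> ?S" for A
  proof -
    \<comment> \<open>Writing the cone as a preimage under radial projection, cut down to the
      punctured ball, shows that it is Borel.\<close>
    have "cone A = (\<lambda>x. x /\<^sub>R norm x) -` A \<inter> (ball 0 1 - {0})"
    proof
      show "cone A \<subseteq> (\<lambda>x. x /\<^sub>R norm x) -` A \<inter> (ball 0 1 - {0})"
        using A(2) by (force simp: cone_def)
      show "(\<lambda>x. x /\<^sub>R norm x) -` A \<inter> (ball 0 1 - {0}) \<subseteq> cone A"
      proof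
        fix x assume x: "x \<in> (\<lambda>x. x /\<^sub>R norm x) -` A \<inter> (ball 0 1 - {0})"
        then have "x = norm x *\<^sub>R (x /\<^sub>R norm x)" "0 < norm x" "norm x < 1" "x /\<^sub>R norm x \<in> A"
          by auto
        then show "x \<in> cone A" unfolding cone_def by blast
      qed
    qed
    moreover have "(\<lambda>x::'a. x /\<^sub>R norm x) -` A \<in> sets borel"
      using measurable_sets[of "\<lambda>x::'a. x /\<^sub>R norm x" borel borel A] A by simp
    ultimately show ?thesis by simp
  qed
  have inv: "emeasure sphere_measure (T -` A \<inter> ?S) = emeasure sphere_measure A"
    if A: "A \<in> sets borel" "A \<subseteq> ?S" for A
  proof -
    have TA: "T -` A \<in> sets borel"
      using measurable_sets[of T borel borel A] A by simp
    have "cone (T -` A \<inter> ?S) = T -` cone A"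
    proof
      show "cone (T -` A \<inter> ?S) \<subseteq> T -` cone A"
        by (auto simp: cone_def linear_cmul[OF lin]) blast
      show "T -` cone A \<subseteq> cone (T -` A \<inter> ?S)"
      proof
        fix x assume "x \<in> T -` cone A"
        then obtain t \<xi> where *: "T x = t *\<^sub>R \<xi>" "0 < t" "t < 1" "\<xi> \<in> A"
          by (auto simp: cone_def)
        \<comment> \<open>The point of the sphere below \<open>x\<close> is
          \<open>x /\<^sub>R t\<close>: its image is the unit vector \<open>\<xi>\<close>, and
          \<open>T\<close> preserves norms.\<close>
        have "T (x /\<^sub>R t) = \<xi>"
          using * by (simp add: linear_cmul[OF lin])
        moreover from this have "norm (x /\<^sub>R t) = 1"
          using iso[of "x /\<^sub>R t"] A * by auto
        moreover have "x = t *\<^sub>R (x /\<^sub>R t)"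
          using * by simp
        ultimately show "x \<in> cone (T -` A \<inter> ?S)"
          using * unfolding cone_def by fastforce
      qed
    qed
    moreover have "emeasure lborel (T -` cone A) = emeasure (distr lborel borel T) (cone A)"
      using cone_meas[OF A] by (simp add: emeasure_distr)
    ultimately show ?thesis
      using em[OF A] em[of "T -` A \<inter> ?S"] TA lborel by simp
  qed
  show ?thesis
  proof (rule measure_eqI)
    fix A assume "A \<in> sets (distr ?\<mu> ?\<mu> T)"
    then have A': "A \<in> sets ?\<mu>"
      by simp
    then have A: "A \<in> sets borel" "A \<subseteq> ?S"
      by (auto simp: sets_normalized_sphere_measure sets_restrict_space_iff)
    have "T -` A \<inter> ?S \<in> sets ?\<mu>"
      using measurable_sets[OF T A'] by (simp add: space_normalized_sphere_measure)
    moreover have "?S \<in> sets sphere_measure"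
      by (simp add: sets_sphere_measure sets_restrict_space_iff)
    \<comment> \<open>Both sides are divided by the same total mass, so invariance survives
      normalization.\<close>
    ultimately have "emeasure ?\<mu> (T -` A \<inter> ?S) = emeasure ?\<mu> A"
      using inv[OF A] A A'
      by (simp add: normalized_sphere_measure_def Int_absorb1)
    then show "emeasure (distr ?\<mu> ?\<mu> T) A = emeasure ?\<mu> A"
      using A' T by (simp add: emeasure_distr space_normalized_sphere_measure)
  qed simp
qed

section \<open>The quadratic form under the integral\<close>

text \<open>The Hermitian form of the diagonal matrix of \<open>\<bar>x\<bar>\<close>, as a real
  sum. With the absolute values built in, it is sublinear in \<open>x\<close> on the whole
  space.\<close>

definition weighted_norm_square :: "real ^ 'n \<Rightarrow> complex ^ 'n \<Rightarrow> real" where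
  "weighted_norm_square x \<xi> = (\<Sum>i\<in>UNIV. \<bar>x $ i\<bar> * (cmod (\<xi> $ i))\<^sup>2)"

lemma abs_vec_nth: "\<bar>x\<bar> $ i = \<bar>x $ i\<bar>" for x :: "real ^ 'n"
  by (simp add: abs_vec_def)

lemma Phi_eq:
  "Phi q x = (LINT \<xi>|normalized_sphere_measure. weighted_norm_square x \<xi> powr q) powr (1 / q)"
  by (simp add: Phi_def H_def hermitian_inner_diag_matrix weighted_norm_square_def abs_vec_nth)

lemma weighted_norm_square_nonneg: "0 \<le> weighted_norm_square x \<xi>"
  by (auto simp: weighted_norm_square_def intro!: sum_nonneg)

lemma weighted_norm_square_mono:
  "(\<And>i. \<bar>x $ i\<bar> \<le> \<bar>y $ i\<bar>) \<Longrightarrow> weighted_norm_square x \<xi> \<le> weighted_norm_square y \<xi>"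
  by (auto simp: weighted_norm_square_def intro!: sum_mono mult_right_mono)

lemma weighted_norm_square_add:
  "weighted_norm_square (x + y) \<xi> \<le> weighted_norm_square x \<xi> + weighted_norm_square y \<xi>"
  by (auto simp: weighted_norm_square_def sum.distrib[symmetric] distrib_right[symmetric]
      intro!: sum_mono mult_right_mono)

lemma weighted_norm_square_scaleR:
  "weighted_norm_square (c *\<^sub>R x) \<xi> = \<bar>c\<bar> * weighted_norm_square x \<xi>"
  by (simp add: weighted_norm_square_def sum_distrib_left abs_mult mult.assoc)

text \<open>Here \<open>1\<close> is the all-ones vector, so the form is constantly 1 on the unit
  sphere.\<close>

lemma weighted_norm_square_1: "weighted_norm_square 1 \<xi> = (norm \<xi>)\<^sup>2"
  by (simp add: weighted_norm_square_def norm_vec_def L2_set_def sum_nonneg)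

text \<open>Reindexing the sum by \<open>inv p\<close> moves the permutation from \<open>x\<close>
  to \<open>\<xi>\<close>, where invariance of the measure can absorb it.\<close>

lemma weighted_norm_square_permute:
  assumes "p permutes UNIV"
  shows "weighted_norm_square (\<chi> i. x $ p i) \<xi> = weighted_norm_square x (\<chi> i. \<xi> $ inv p i)"
  unfolding weighted_norm_square_def
  using permutes_inverses[OF assms] permutes_inv[OF assms]
  by (subst sum.permute[OF permutes_inv[OF assms]]) (simp add: o_def)

lemma weighted_norm_square_measurable [measurable]:
  "weighted_norm_square x \<in> borel_measurable normalized_sphere_measure"
proof (rule borel_measurable_normalized_sphere_measure)
  show "weighted_norm_square x \<in> borel_measurable borel"
    unfolding weighted_norm_square_def[abs_def]
    by (intro borel_measurable_continuous_onI continuous_intros)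
qed

text \<open>On the sphere the form is bounded by the sum of the \<open>\<bar>x $ i\<bar>\<close>,
  and bounded measurable functions are integrable over a probability space.\<close>

lemma integrable_weighted_norm_square_powr:
  fixes x :: "real ^ 'n"
  assumes q: "0 \<le> q"
  shows "integrable normalized_sphere_measure (\<lambda>\<xi>. weighted_norm_square x \<xi> powr q)"
proof -
  interpret prob_space "normalized_sphere_measure :: (complex ^ 'n) measure"
    by (rule prob_space_normalized_sphere_measure)
  have le: "weighted_norm_square x \<xi> \<le> (\<Sum>i\<in>UNIV. \<bar>x $ i\<bar>)" if "norm \<xi> = 1" for \<xi>
    unfolding weighted_norm_square_def
  proof (rule sum_mono)
    fix i
    have "(cmod (\<xi> $ i))\<^sup>2 \<le> 1"
      using Finite_Cartesian_Product.norm_nth_le[of \<xi> i] that by (simp add: power_le_one)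
    then show "\<bar>x $ i\<bar> * (cmod (\<xi> $ i))\<^sup>2 \<le> \<bar>x $ i\<bar>"
      by (simp add: mult_left_le)
  qed
  show ?thesis
    by (rule integrable_const_bound[where B = "(\<Sum>i\<in>UNIV. \<bar>x $ i\<bar>) powr q"])
      (auto simp: space_normalized_sphere_measure q
        intro!: AE_I2 powr_mono2 le weighted_norm_square_nonneg)
qed

section \<open>Norm properties and permutation symmetry of \<open>Phi q\<close>\<close>

context
  fixes q :: real
  assumes q: "1 \<le> q"
begin

lemma Phi_nonneg: "0 \<le> Phi q x"
  by (simp add: Phi_eq)

lemma Phi_mono: "(\<And>i. \<bar>x $ i\<bar> \<le> \<bar>y $ i\<bar>) \<Longrightarrow> Phi q x \<le> Phi q y"
  unfolding Phi_eq using q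
  by (intro powr_mono2 integral_mono integrable_weighted_norm_square_powr
      weighted_norm_square_mono weighted_norm_square_nonneg integral_nonneg) auto

lemma Phi_add: "Phi q (x + y) \<le> Phi q x + Phi q y"
proof -
  \<comment> \<open>Comparing the integrals below requires the majorant to be integrable.\<close>
  have int: "integrable normalized_sphere_measure
      (\<lambda>\<xi>. (weighted_norm_square x \<xi> + weighted_norm_square y \<xi>) powr q)"
    using q by (intro integrable_powr_add integrable_weighted_norm_square_powr
        weighted_norm_square_nonneg) auto
  have "Phi q (x + y) \<le> (LINT \<xi>|normalized_sphere_measure.
      (weighted_norm_square x \<xi> + weighted_norm_square y \<xi>) powr q) powr (1 / q)"
    unfolding Phi_eq using q
    by (intro powr_mono2 integral_mono integrable_weighted_norm_square_powr int
        weighted_norm_square_add weighted_norm_square_nonneg integral_nonneg) auto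
  also have "\<dots> \<le> Phi q x + Phi q y"
    unfolding Phi_eq using q
    by (intro Minkowski_integral_powr integrable_weighted_norm_square_powr
        weighted_norm_square_nonneg) auto
  finally show ?thesis .
qed

lemma Phi_scaleR: "Phi q (c *\<^sub>R x) = \<bar>c\<bar> * Phi q x"
  using q by (simp add: Phi_eq weighted_norm_square_scaleR powr_mult powr_powr
      weighted_norm_square_nonneg)

lemma Phi_1: "Phi q (1 :: real ^ 'n) = 1"
proof -
  interpret prob_space "normalized_sphere_measure :: (complex ^ 'n) measure"
    by (rule prob_space_normalized_sphere_measure)
  have "(LINT \<xi>|normalized_sphere_measure. weighted_norm_square (1 :: real ^ 'n) \<xi> powr q)
      = (LINT \<xi>|(normalized_sphere_measure :: (complex ^ 'n) measure). 1)"
    by (rule Bochner_Integration.integral_cong)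
      (auto simp: weighted_norm_square_1 space_normalized_sphere_measure)
  then show ?thesis
    by (simp add: Phi_eq prob_space)
qed

text \<open>A change of variables on the sphere, along the permutation of the coordinates of
  \<open>\<xi>\<close>.\<close>

lemma Phi_permute:
  fixes x :: "real ^ 'n"
  assumes p: "p permutes UNIV"
  shows "Phi q (\<chi> i. x $ p i) = Phi q x"
proof -
  define T :: "complex ^ 'n \<Rightarrow> complex ^ 'n" where "T \<xi> = (\<chi> i. \<xi> $ inv p i)" for \<xi>
  \<comment> \<open>\<open>\<pi>\<close> is both the inverse and the adjoint of \<open>T\<close>; as
    the adjoint it describes how \<open>T\<close> acts on coordinates.\<close>
  define \<pi> :: "complex ^ 'n \<Rightarrow> complex ^ 'n" where "\<pi> \<xi> = (\<chi> i. \<xi> $ p i)" for \<xi>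
  have T_axis: "T (axis i b) = axis (p i) b" for i b
    using permutes_inverses[OF p] by (auto simp: T_def axis_def vec_eq_iff)
  have \<pi>_axis: "\<pi> (axis i b) = axis (inv p i) b" for i b
    using permutes_inverses[OF p] by (auto simp: \<pi>_def axis_def vec_eq_iff)
  have T_\<pi>: "T (\<pi> \<xi>) = \<xi>" "\<pi> (T \<xi>) = \<xi>" for \<xi>
    using permutes_inverses[OF p] by (auto simp: \<pi>_def T_def)
  \<comment> \<open>The real basis consists of the vectors \<open>axis i b\<close> with
    \<open>b\<close> in the basis of the complex numbers, so permuting the indices permutes the
    basis.\<close>
  have bij: "bij_betw \<pi> Basis Basis"
    by (rule bij_betw_byWitness[where f' = T])
      (simp_all add: T_\<pi>, auto simp: Basis_vec_def T_axis \<pi>_axis, blast+)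
  have inner: "T \<xi> \<bullet> b = \<xi> \<bullet> \<pi> b" for \<xi> b
    unfolding inner_vec_def
    by (subst sum.permute[OF p]) (simp add: o_def T_def \<pi>_def permutes_inverses[OF p])
  have lin: "linear T"
    by (rule linearI) (simp_all add: T_def vec_eq_iff)
  have "norm (T \<xi>) = norm \<xi>" for \<xi>
    by (simp add: norm_eq_sqrt_inner inner T_\<pi>)
  then have iso: "norm (T \<xi>) = norm \<xi>" for \<xi> .
  have T_borel: "T \<in> borel_measurable borel"
    using lin by (rule borel_measurable_linear)
  have T_meas: "T \<in> normalized_sphere_measure \<rightarrow>\<^sub>M normalized_sphere_measure"
    by (rule measurable_normalized_sphere_measure) (auto simp: T_borel iso)
  have distr:
    "distr normalized_sphere_measure normalized_sphere_measure T = normalized_sphere_measure"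
    by (rule normalized_sphere_measure_distr[OF lborel_distr_permute_Basis[OF bij inner T_borel] lin iso])
  have "(LINT \<xi>|normalized_sphere_measure. weighted_norm_square (\<chi> i. x $ p i) \<xi> powr q)
      = (LINT \<xi>|normalized_sphere_measure. weighted_norm_square x (T \<xi>) powr q)"
    by (simp add: weighted_norm_square_permute[OF p] T_def)
  also have "\<dots> = (LINT \<xi>|distr normalized_sphere_measure normalized_sphere_measure T.
      weighted_norm_square x \<xi> powr q)"
    by (rule integral_distr[symmetric]) (use T_meas in measurable)
  finally show ?thesis
    by (simp add: Phi_eq distr)
qed

lemma Phi_axis_pos: "0 < Phi q (axis k 1 :: real ^ 'n)"
proof (rule ccontr)
  assume "\<not> ?thesis"
  then have k: "Phi q (axis k 1 :: real ^ 'n) = 0"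
    using Phi_nonneg[of "axis k 1 :: real ^ 'n"] by linarith
  have zero: "Phi q (axis j 1 :: real ^ 'n) = 0" for j
  proof -
    \<comment> \<open>Swapping coordinates \<open>j\<close> and \<open>k\<close> turns one basis
      vector into the other, so all of them share the value 0.\<close>
    have "(\<chi> i. axis k 1 $ Transposition.transpose j k i) = (axis j 1 :: real ^ 'n)"
      by (auto simp: vec_eq_iff axis_def Transposition.transpose_def)
    then show ?thesis
      using Phi_permute[OF permutes_swap_id[of j UNIV k], of "axis k 1"] k by simp
  qed
  \<comment> \<open>The empty sum and, by convention, a sum over an infinite \<open>A\<close> are 0;
    homogeneity with factor 0 covers both.\<close>
  have "Phi q (\<Sum>j\<in>A. axis j 1 :: real ^ 'n) \<le> 0" for A
    by (induction A rule: infinite_finite_induct)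
       (use Phi_scaleR[of 0 "0 :: real ^ 'n"] Phi_add zero in \<open>auto intro: order_trans[OF Phi_add]\<close>)
  moreover have "(\<Sum>j\<in>UNIV. axis j 1) = (1 :: real ^ 'n)"
    by (simp add: vec_eq_iff axis_def)
  ultimately show False
    using Phi_1[where 'n='n] by (metis not_one_le_zero)
qed

lemma Phi_eq_0_iff: "Phi q x = 0 \<longleftrightarrow> x = 0"
proof
  assume 0: "Phi q x = 0"
  have "x $ k = 0" for k
  proof -
    have "\<bar>x $ k\<bar> * Phi q (axis k 1) = Phi q ((x $ k) *\<^sub>R axis k 1)"
      by (simp add: Phi_scaleR)
    also have "\<dots> \<le> Phi q x"
      by (rule Phi_mono) (simp add: axis_def)
    finally show ?thesis
      using 0 Phi_axis_pos[of k] by (simp add: mult_le_0_iff)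
  qed
  then show "x = 0"
    by (simp add: vec_eq_iff)
qed (use Phi_scaleR[of 0 0] in simp)

end

theorem theorem3p1:
  fixes q :: real
  assumes "1 \<le> q"
  shows "symmetric_gauge (Phi q :: real ^ 'n \<Rightarrow> real)"
proof -
  \<comment> \<open>\<open>Phi\<close> depends on \<open>x\<close> only through
    \<open>\<bar>x\<bar>\<close>, which sign changes leave fixed.\<close>
  have "\<bar>\<chi> i. s i * x $ i\<bar> = \<bar>x\<bar>" if "\<forall>i. s i \<in> {- 1, 1}" for s and x :: "real ^ 'n"
    using that by (auto simp: vec_eq_iff abs_vec_nth abs_mult) (metis abs_minus_cancel abs_one mult_1)
  then show ?thesis
    unfolding symmetric_gauge_def is_norm_def
    using Phi_nonneg Phi_eq_0_iff[OF assms] Phi_scaleR[OF assms] Phi_add[OF assms]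
      Phi_permute[OF assms]
    by (auto simp: Phi_def)
qed

end
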